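(* Let $n\ge5$ and let $U\subsetneq V(G_n)$ with $|U_X|\ge3$ and $|U_Y|\ge3$, where $U_X=U\cap X$ and $U_Y=U\cap Y$. If $G_n[U]$ is disconnected, then $|U_X|=|U_Y|=3$ and $F_n[U]\cong P_6$ or $F_n[U]\cong2P_3$. In particular, if $|U_X|,|U_Y|\ge3$ and $|U|\ge7$, then $G_n[U]$ is connected.
   Context: Graph $G_n$: let $X=\{u_0,\dots,u_{n-1}\}$ and $Y=\{v_0,\dots,v_{n-1}\}$ be disjoint, indices modulo $n$. Let $F_n\cong C_{2n}$ be the cycle on $X\sqcup Y$ with edges $\{u_i,v_i\},\{u_i,v_{i-1}\}$, $i\in\mathbb Z_n$, and $G_n=K_{X,Y}\setminus E(F_n)$, i.e. $\{u_i,v_j\}\in E(G_n)$ iff $j\notin\{i,i-1\}$ modulo $n$. $V(G_n)=X\sqcup Y$. $G[U]$ denotes the subgraph of $G$ induced on $U$; $P_r$ is the path on $r$ vertices and $2P_3=P_3\sqcup P_3$. *)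

theory Defs
  imports "Graph_Theory.Graph_Theory" "HOL-Number_Theory.Cong"
begin

text \<open>
  A simple graph is represented, as usual with Graph_Theory, by a loop-free symmetric digraph
  without parallel arcs (\<^locale>\<open>pair_graph\<close>): the edge \<open>{x, y}\<close> is the pair of arcs
  \<open>(x, y)\<close>, \<open>(y, x)\<close>.
\<close>

definition u_vert :: "nat \<Rightarrow> int \<Rightarrow> int + int" where
  "u_vert n i = Inl (i mod int n)"

definition v_vert :: "nat \<Rightarrow> int \<Rightarrow> int + int" where
  "v_vert n i = Inr (i mod int n)"

definition X_part :: "nat \<Rightarrow> (int + int) set" where
  "X_part n = u_vert n ` {0..<int n}"

definition Y_part :: "nat \<Rightarrow> (int + int) set" where
  "Y_part n = v_vert n ` {0..<int n}"

definition F_graph :: "nat \<Rightarrow> (int + int) pair_pre_digraph" where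
  "F_graph n = \<lparr> pverts = X_part n \<union> Y_part n,
    parcs = (\<Union>i\<in>{0..<int n}.
      {(u_vert n i, v_vert n i), (v_vert n i, u_vert n i), (u_vert n i, v_vert n (i - 1)), (v_vert n (i - 1), u_vert n i)}) \<rparr>"

definition G_graph :: "nat \<Rightarrow> (int + int) pair_pre_digraph" where
  "G_graph n = \<lparr> pverts = X_part n \<union> Y_part n, parcs = (X_part n \<times> Y_part n \<union> Y_part n \<times> X_part n) - parcs (F_graph n) \<rparr>"

definition path_graph :: "nat \<Rightarrow> nat pair_pre_digraph" where
  "path_graph r = \<lparr> pverts = {0..<r},
    parcs = {(a, b). a < r \<and> b < r \<and> (b = Suc a \<or> a = Suc b)} \<rparr>"

definition disjoint_union ::
  "'a pair_pre_digraph \<Rightarrow> 'b pair_pre_digraph \<Rightarrow> ('a + 'b) pair_pre_digraph" where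
  "disjoint_union H K = \<lparr> pverts = Inl ` pverts H \<union> Inr ` pverts K,
    parcs = map_prod Inl Inl ` parcs H \<union> map_prod Inr Inr ` parcs K \<rparr>"

lemma u_v_arc_F:
  assumes "n > 0"
  shows "(u_vert n i, v_vert n j) \<in> parcs (F_graph n) \<longleftrightarrow> [j = i] (mod int n) \<or> [j = i - 1] (mod int n)"
proof -
  have *: "(u_vert n i, v_vert n j) \<in> parcs (F_graph n) \<longleftrightarrow>
      (\<exists>k\<in>{0..<int n}. i mod int n = k \<and> (j mod int n = k \<or> j mod int n = (k - 1) mod int n))"
    by (auto simp: F_graph_def u_vert_def v_vert_def)
  have "i mod int n \<in> {0..<int n}" using assms by simp
  then show ?thesis unfolding * cong_def by (auto simp: mod_diff_left_eq)
qed

lemma u_v_arc_G: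
  assumes "n > 0"
  shows "(u_vert n i, v_vert n j) \<in> parcs (G_graph n) \<longleftrightarrow> \<not> [j = i] (mod int n) \<and> \<not> [j = i - 1] (mod int n)"
proof -
  have "i mod int n \<in> {0..<int n}" "j mod int n \<in> {0..<int n}" using assms by simp_all
  then have "u_vert n i \<in> X_part n" "v_vert n j \<in> Y_part n"
    by (auto simp: X_part_def Y_part_def u_vert_def v_vert_def image_iff intro!: bexI)
  then show ?thesis using u_v_arc_F[OF assms, of i j] by (auto simp: G_graph_def)
qed

lemma pair_graph_F: "pair_graph (F_graph n)"
proof (cases "n = 0")
  case True
  then show ?thesis
    by unfold_locales (auto simp: F_graph_def X_part_def Y_part_def symmetric_def sym_def)
next
  case False
  then have "k mod int n \<in> {0..<int n}" for k by simp
  then have "u_vert n k \<in> X_part n" "v_vert n k \<in> Y_part n" for k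
    by (auto simp: X_part_def Y_part_def u_vert_def v_vert_def image_iff intro!: bexI)
  then show ?thesis
    by unfold_locales
      (auto simp: F_graph_def symmetric_def sym_def u_vert_def v_vert_def X_part_def Y_part_def)
qed

lemma pair_graph_G: "pair_graph (G_graph n)"
proof -
  interpret FG: pair_graph "F_graph n" by (rule pair_graph_F)
  have "sym (parcs (F_graph n))" using FG.pair_sym_arcs by (simp add: symmetric_def)
  then have "sym (parcs (G_graph n))" by (auto simp: G_graph_def sym_def)
  moreover have "X_part n \<inter> Y_part n = {}" by (auto simp: X_part_def Y_part_def u_vert_def v_vert_def)
  moreover have "finite (X_part n)" "finite (Y_part n)" by (auto simp: X_part_def Y_part_def)
  ultimately show ?thesis
    by unfold_locales (auto simp: symmetric_def G_graph_def)
qed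

end

theory Submission
  imports Defs
begin

text \<open>
  If the subgraph of \<open>G\<close> induced on \<open>U\<close> is disconnected, then \<open>U\<close> is the disjoint union of two nonempty
  sets \<open>A\<close> and \<open>B\<close> without \<open>G\<close>-edges between them. As \<open>G\<close> is the complement of the cycle \<open>F\<close> in
  \<open>K_{X,Y}\<close>, the pairs \<open>(A \<inter> X, B \<inter> Y)\<close> and \<open>(B \<inter> X, A \<inter> Y)\<close> then span complete bipartite subgraphs
  of \<open>F\<close>. In a cycle of length at least 6, a complete bipartite subgraph with two nonempty sides has at
  most three vertices, and when it has three they are consecutive on the cycle (\<open>biclique_F\<close>).
  None of the four sets is empty: if \<open>A \<inter> X\<close> were, then \<open>B \<inter> X\<close> would contain
  at least three vertices, more than any vertex of \<open>A \<inter> Y\<close> has neighbours in \<open>F\<close>, so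
  \<open>A \<inter> Y\<close> and hence \<open>A\<close> would be empty; the other cases are symmetric.

  Hence the two bicliques have together at most six vertices. But they partition \<open>U\<close>, which has at least
  three vertices in each of \<open>X\<close> and \<open>Y\<close>. So all these bounds are attained, and \<open>U\<close> consists of two
  disjoint arcs of three consecutive vertices of the cycle. If \<open>n \<ge> 4\<close> these arcs touch on at most one
  side, so that \<open>F\<close> induces \<open>P\<^sub>6\<close> or \<open>2P\<^sub>3\<close> on their union (\<open>two_disjoint_arcs\<close>). The connectedness for
  \<open>card U \<ge> 7\<close> is the contrapositive of the cardinality part.

  All computations in \<open>F\<close> are done along the closed walk \<open>cyc\<close>, which turns equality and adjacency of
  vertices into congruences modulo \<open>2n\<close>.
\<close>

section \<open>Splitting disconnected graphs and building isomorphisms\<close>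

text \<open>
  One side is the set of vertices reachable from a vertex \<open>u\<close> that does not reach everything.
  Symmetry of the arc relation excludes arcs in either direction.
\<close>

lemma disconnected_split:
  assumes "sym (parcs H)" "U \<noteq> {}"
    and "\<not> Digraph_Component.connected (with_proj H \<restriction> U)"
  obtains A B where "A \<union> B = U" "A \<inter> B = {}" "A \<noteq> {}" "B \<noteq> {}"
    "\<And>a b. a \<in> A \<Longrightarrow> b \<in> B \<Longrightarrow> (a, b) \<notin> parcs H \<and> (b, a) \<notin> parcs H"
proof -
  let ?M = "with_proj (mk_symmetric (with_proj H \<restriction> U))"
  have verts: "verts ?M = U"
    by (simp add: mk_symmetric_def)
  obtain u v where uv: "u \<in> U" "v \<in> U" "\<not> reachable ?M u v"
    using assms(2,3) verts by (auto simp: connected_def strongly_connected_def)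
  define A where "A = {w \<in> U. reachable ?M u w}"
  have step: "reachable ?M u b" if "reachable ?M u a" "a \<in> U" "b \<in> U" "(a, b) \<in> parcs H" for a b
  proof -
    have "(a, b) \<in> arcs_ends ?M"
      using that by (force simp: mk_symmetric_def arcs_ends_def arc_to_ends_def)
    with that(1) show ?thesis
      using that(3) verts unfolding reachable_def by (metis rtrancl_on_into_rtrancl_on)
  qed
  have "u \<in> A"
    using uv verts by (auto simp: A_def reachable_def)
  moreover have "v \<in> U - A"
    using uv by (auto simp: A_def)
  moreover have "(a, b) \<notin> parcs H \<and> (b, a) \<notin> parcs H" if "a \<in> A" "b \<in> U - A" for a b
    using that step assms(1) by (auto simp: A_def dest: symD)
  ultimately show ?thesis
    using that[of A "U - A"] by (auto simp: A_def)
qed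

text \<open>
  Arcs are pairs of vertices on both sides, so an isomorphism amounts to a bijection of vertices
  that preserves and reflects arcs. The bijection goes from the model \<open>H\<close> into the ambient graph, opposite
  to the isomorphism, because a parametrisation of \<open>U\<close> by the vertices of \<open>H\<close> is easy to write down.
\<close>

lemma digraph_iso_inducedI:
  assumes bij: "bij_betw f (pverts H) U"
    and arcs: "\<And>x y. x \<in> pverts H \<Longrightarrow> y \<in> pverts H \<Longrightarrow>
      (f x, f y) \<in> parcs F \<longleftrightarrow> (x, y) \<in> parcs H"
    and wf: "parcs H \<subseteq> pverts H \<times> pverts H"
  shows "digraph_iso (with_proj F \<restriction> U) (with_proj H)"
proof -
  define g where "g = the_inv_into (pverts H) f"
  have inj: "inj_on f (pverts H)" and im: "f ` pverts H = U"
    using bij by (auto simp: bij_betw_def)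
  have gf: "g (f x) = x" if "x \<in> pverts H" for x
    using that inj by (simp add: g_def the_inv_into_f_f)
  have bij': "bij_betw g U (pverts H)"
    unfolding g_def by (rule bij_betw_the_inv_into[OF bij])
  then have inj': "inj_on g U" and im': "g ` U = pverts H"
    by (auto simp: bij_betw_def)
  let ?E = "{e \<in> parcs F. fst e \<in> U \<and> snd e \<in> U}"
  have "map_prod g g ` ?E = parcs H"
  proof (intro equalityI subsetI)
    fix e assume "e \<in> map_prod g g ` ?E"
    then obtain x y where "e = (g (f x), g (f y))" "x \<in> pverts H" "y \<in> pverts H"
      "(f x, f y) \<in> parcs F"
      using im by auto
    then show "e \<in> parcs H"
      using arcs gf by auto
  next
    fix e assume e: "e \<in> parcs H"
    then obtain x y where xy: "e = (x, y)" "x \<in> pverts H" "y \<in> pverts H"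
      using wf by auto
    then have "(f x, f y) \<in> ?E"
      using e arcs im by auto
    moreover have "e = map_prod g g (f x, f y)"
      using xy gf by simp
    ultimately show "e \<in> map_prod g g ` ?E"
      by blast
  qed
  moreover have "inj_on (map_prod g g) ?E"
    by (rule inj_on_subset[OF map_prod_inj_on[OF inj' inj']]) auto
  ultimately show ?thesis
    unfolding digraph_iso_def
    by (intro exI[of _ "\<lparr>iso_verts = g, iso_arcs = map_prod g g, iso_head = snd, iso_tail = fst\<rparr>"])
      (auto simp: pre_digraph.digraph_isomorphism_def app_iso_def inj' im' wf_digraph_def)
qed

section \<open>Walking around the cycle\<close>

text \<open>
  The bi-infinite walk \<open>\<dots>, u\<^sub>0, v\<^sub>0, u\<^sub>1, v\<^sub>1, \<dots>\<close> that winds around \<open>F\<close>, with period \<open>2n\<close>. Indexing it by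
  all integers avoids wrapping positions around.
\<close>

definition cyc :: "nat \<Rightarrow> int \<Rightarrow> int + int" where
  "cyc n k = (if even k then u_vert n (k div 2) else v_vert n (k div 2))"

lemma cyc_double [simp]: "cyc n (2 * i) = u_vert n i" "cyc n (2 * i + 1) = v_vert n i"
  by (simp_all add: cyc_def)

lemma cyc_cases:
  fixes k :: int
  obtains i where "k = 2 * i" | i where "k = 2 * i + 1"
  by (metis evenE oddE)

lemma cong_double_iff: "[2 * i = 2 * j] (mod 2 * m) \<longleftrightarrow> [i = j] (mod m)" for i j m :: int
  using dvd_times_left_cancel_iff[of 2 m "i - j"] by (simp add: cong_iff_dvd_diff)

lemma not_cong_parity: "even i \<noteq> even j \<Longrightarrow> \<not> [i = j] (mod 2 * m)" for i j m :: int
  by (metis cong_dvd_iff cong_dvd_modulus dvd_triv_left)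

lemma cyc_eq_iff: "cyc n k = cyc n l \<longleftrightarrow> [k = l] (mod 2 * int n)"
proof (cases k rule: cyc_cases; cases l rule: cyc_cases)
  fix i j assume "k = 2 * i" "l = 2 * j"
  then show ?thesis by (simp add: u_vert_def cong_double_iff) (simp add: cong_def)
next
  fix i j assume "k = 2 * i + 1" "l = 2 * j + 1"
  then show ?thesis by (simp add: v_vert_def cong_add_rcancel cong_double_iff) (simp add: cong_def)
qed (simp_all add: u_vert_def v_vert_def not_cong_parity)

lemma sym_F: "sym (parcs (F_graph n))"
  by (auto simp: F_graph_def sym_def)

lemma sym_G: "sym (parcs (G_graph n))"
  using sym_F[of n] by (auto simp: G_graph_def sym_def)

lemma cyc_arc_iff:
  assumes "n > 0"
  shows "(cyc n k, cyc n l) \<in> parcs (F_graph n) \<longleftrightarrow>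
    [l = k + 1] (mod 2 * int n) \<or> [l = k - 1] (mod 2 * int n)"
proof -
  have odd: "(cyc n (2 * i), cyc n (2 * j + 1)) \<in> parcs (F_graph n) \<longleftrightarrow>
    [2 * j + 1 = 2 * i + 1] (mod 2 * int n) \<or> [2 * j + 1 = 2 * i - 1] (mod 2 * int n)" for i j
  proof -
    have "[2 * j + 1 = 2 * i - 1] (mod 2 * int n) \<longleftrightarrow> [j = i - 1] (mod int n)"
      using cong_double_iff[of j "i - 1" "int n"] by (simp add: cong_iff_dvd_diff algebra_simps)
    then show ?thesis
      using u_v_arc_F[OF assms, of i j] by (simp add: cong_add_rcancel cong_double_iff)
  qed
  show ?thesis
  proof (cases k rule: cyc_cases; cases l rule: cyc_cases)
    fix i j assume "k = 2 * i" "l = 2 * j + 1"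
    then show ?thesis using odd by blast
  next
    fix i j assume *: "k = 2 * i + 1" "l = 2 * j"
    have "(cyc n k, cyc n l) \<in> parcs (F_graph n) \<longleftrightarrow> (cyc n l, cyc n k) \<in> parcs (F_graph n)"
      using sym_F by (meson symD)
    also have "\<dots> \<longleftrightarrow> [k = l + 1] (mod 2 * int n) \<or> [k = l - 1] (mod 2 * int n)"
      using odd * by blast
    also have "\<dots> \<longleftrightarrow> [l = k + 1] (mod 2 * int n) \<or> [l = k - 1] (mod 2 * int n)"
      by (smt (verit, best) cong_iff_dvd_diff dvd_diff_commute)
    finally show ?thesis .
  qed (auto simp: F_graph_def u_vert_def v_vert_def not_cong_parity)
qed

lemma vertex_cyc: "w \<in> X_part n \<union> Y_part n \<Longrightarrow> \<exists>k. w = cyc n k"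
  by (auto simp: X_part_def Y_part_def simp flip: cyc_double)

text \<open>
  For positions in a window shorter than the cycle the congruences become plain equations. For adjacency
  the window loses one more position, as positions at distance \<open>2n - 1\<close> are neighbours.
\<close>

lemma cyc_eq_near_iff: "\<bar>k - l\<bar> < 2 * int n \<Longrightarrow> cyc n k = cyc n l \<longleftrightarrow> k = l"
  using zdvd_not_zless[of "\<bar>k - l\<bar>" "2 * int n"] by (auto simp: cyc_eq_iff cong_iff_dvd_diff)

lemma cyc_arc_near_iff:
  assumes "\<bar>k - l\<bar> \<le> 2 * int n - 2" "n > 0"
  shows "(cyc n k, cyc n l) \<in> parcs (F_graph n) \<longleftrightarrow> \<bar>k - l\<bar> = 1"
proof -
  have "cyc n l = cyc n (k + 1) \<longleftrightarrow> l = k + 1" "cyc n l = cyc n (k - 1) \<longleftrightarrow> l = k - 1"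
    using assms by (intro cyc_eq_near_iff; linarith)+
  then show ?thesis
    using cyc_arc_iff[OF assms(2), of k l] by (auto simp: cyc_eq_iff)
qed

lemma neighbours_cyc:
  assumes "n > 0" "(cyc n k, w) \<in> parcs (F_graph n)"
  shows "w \<in> {cyc n (k - 1), cyc n (k + 1)}"
proof -
  interpret pair_graph "F_graph n"
    by (rule pair_graph_F)
  have "w \<in> X_part n \<union> Y_part n"
    using in_arcsD2[OF assms(2)] by (simp add: F_graph_def)
  then show ?thesis
    using assms vertex_cyc[of w n] by (auto simp: cyc_arc_iff cyc_eq_iff)
qed

section \<open>Bicliques in the cycle\<close>

definition arc3 :: "nat \<Rightarrow> int \<Rightarrow> (int + int) set" where
  "arc3 n p = {cyc n p, cyc n (p + 1), cyc n (p + 2)}"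

lemma cyc_neighbours_distinct: "n \<ge> 2 \<Longrightarrow> cyc n (k - 1) \<noteq> cyc n (k + 1)"
  by (subst cyc_eq_near_iff) auto

text \<open>
  The other neighbours of the two vertices sit at positions \<open>k - 2\<close> and \<open>k + 2\<close>, which differ modulo
  \<open>2n\<close> since \<open>2n\<close> does not divide 4. In other words, \<open>F\<close> has no 4-cycle.
\<close>

lemma common_neighbour_unique:
  assumes "n \<ge> 3" "(cyc n (k - 1), w) \<in> parcs (F_graph n)" "(cyc n (k + 1), w) \<in> parcs (F_graph n)"
  shows "w = cyc n k"
proof -
  have "w \<in> {cyc n (k - 2), cyc n k}" "w \<in> {cyc n k, cyc n (k + 2)}"
    using neighbours_cyc[OF _ assms(2)] neighbours_cyc[OF _ assms(3)] assms(1) by (auto simp: add.commute)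
  moreover have "cyc n (k - 2) \<noteq> cyc n (k + 2)"
    using assms(1) by (subst cyc_eq_near_iff) auto
  ultimately show ?thesis
    by blast
qed

text \<open>
  The side \<open>Q\<close> lies in the neighbourhood of any vertex of \<open>P\<close>; if it has two elements it is the whole
  neighbourhood, and the absence of 4-cycles leaves room for just one vertex in \<open>P\<close>, the middle one of
  the arc.
\<close>

lemma biclique_side:
  assumes "n \<ge> 3" "P \<times> Q \<subseteq> parcs (F_graph n)" "P \<noteq> {}" "P \<subseteq> X_part n \<union> Y_part n"
  shows "card Q \<le> 2" and "card Q = 2 \<Longrightarrow> card P = 1 \<and> (\<exists>p. P \<union> Q = arc3 n p)"
proof -
  obtain k where k: "cyc n k \<in> P"
    using assms(3,4) vertex_cyc by blast
  have Q: "Q \<subseteq> {cyc n (k - 1), cyc n (k + 1)}"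
    using neighbours_cyc[of n k] k assms(1,2) by auto
  show "card Q \<le> 2"
    using card_mono[OF _ Q] card_insert_le_m1[of 2 "{cyc n (k + 1)}" "cyc n (k - 1)"] by simp
  assume "card Q = 2"
  with Q have Q_eq: "Q = {cyc n (k - 1), cyc n (k + 1)}"
    using cyc_neighbours_distinct[of n k] assms(1) by (intro card_subset_eq) auto
  have "w = cyc n k" if "w \<in> P" for w
  proof (rule common_neighbour_unique[OF assms(1)])
    show "(cyc n (k - 1), w) \<in> parcs (F_graph n)" "(cyc n (k + 1), w) \<in> parcs (F_graph n)"
      using that assms(2) Q_eq sym_F[of n] by (auto dest: symD)
  qed
  with k have P_eq: "P = {cyc n k}"
    by blast
  have "P \<union> Q = arc3 n (k - 1)"
    unfolding P_eq Q_eq arc3_def by (auto simp: algebra_simps)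
  with P_eq show "card P = 1 \<and> (\<exists>p. P \<union> Q = arc3 n p)"
    by auto
qed

lemma biclique_F:
  assumes "n \<ge> 3" "P \<times> Q \<subseteq> parcs (F_graph n)" "P \<noteq> {}" "Q \<noteq> {}" "P \<union> Q \<subseteq> X_part n \<union> Y_part n"
  shows "card P + card Q \<le> 3" and "card P + card Q = 3 \<Longrightarrow> \<exists>p. P \<union> Q = arc3 n p"
proof -
  have "Q \<times> P \<subseteq> parcs (F_graph n)"
    using assms(2) sym_F[of n] by (auto dest: symD)
  moreover have "P \<subseteq> X_part n \<union> Y_part n" "Q \<subseteq> X_part n \<union> Y_part n"
    using assms(5) by simp_all
  ultimately have Q_side: "card Q \<le> 2" "card Q = 2 \<Longrightarrow> card P = 1 \<and> (\<exists>p. P \<union> Q = arc3 n p)"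
    and P_side: "card P \<le> 2" "card P = 2 \<Longrightarrow> card Q = 1 \<and> (\<exists>p. Q \<union> P = arc3 n p)"
    using biclique_side[OF assms(1,2,3)] biclique_side[OF assms(1) _ assms(4), of P] by blast+
  have "\<not> (card P = 2 \<and> card Q = 2)"
    using P_side(2) by linarith
  then show "card P + card Q \<le> 3"
    using Q_side(1) P_side(1) by linarith
  assume "card P + card Q = 3"
  then consider "card P = 2" | "card Q = 2"
    using Q_side(1) P_side(1) by linarith
  then show "\<exists>p. P \<union> Q = arc3 n p"
    using Q_side(2) P_side(2) by cases (simp_all add: Un_commute)
qed

section \<open>Two disjoint arcs of the cycle\<close>

lemma digraph_iso_path6:
  assumes "n \<ge> 4"
  shows "digraph_iso (with_proj (F_graph n) \<restriction> (arc3 n p \<union> arc3 n (p + 3))) (with_proj (path_graph 6))"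
proof (rule digraph_iso_inducedI[where f = "\<lambda>m. cyc n (p + int m)"])
  have "inj_on (\<lambda>m. cyc n (p + int m)) {0..<6}"
    using assms by (intro inj_onI) (subst (asm) cyc_eq_near_iff, auto)
  moreover have "{0..<6} = {0, 1, 2, 3, 4, 5 :: nat}"
    by auto
  ultimately show "bij_betw (\<lambda>m. cyc n (p + int m)) (pverts (path_graph 6)) (arc3 n p \<union> arc3 n (p + 3))"
    by (simp add: bij_betw_def path_graph_def arc3_def insert_commute add.assoc)
next
  fix x y assume "x \<in> pverts (path_graph 6)" "y \<in> pverts (path_graph 6)"
  then show "(cyc n (p + int x), cyc n (p + int y)) \<in> parcs (F_graph n) \<longleftrightarrow> (x, y) \<in> parcs (path_graph 6)"
    using assms by (subst cyc_arc_near_iff) (auto simp: path_graph_def)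
qed (auto simp: path_graph_def)

lemma digraph_iso_two_path3:
  assumes "p + 4 \<le> q" "q + 4 \<le> p + 2 * int n"
  shows "digraph_iso (with_proj (F_graph n) \<restriction> (arc3 n p \<union> arc3 n q))
    (with_proj (disjoint_union (path_graph 3) (path_graph 3)))" (is "digraph_iso _ (with_proj ?H)")
proof (rule digraph_iso_inducedI)
  define pos where "pos = case_sum (\<lambda>m. p + int m) (\<lambda>m. q + int m)"
  let ?f = "\<lambda>x. cyc n (pos x)"
  have verts: "pverts ?H = Inl ` {0, 1, 2} \<union> Inr ` {0, 1, 2}"
    by (auto simp: disjoint_union_def path_graph_def)
  have near: "\<bar>pos x - pos y\<bar> \<le> 2 * int n - 2" if "x \<in> pverts ?H" "y \<in> pverts ?H" for x y
    using that assms by (auto simp: verts pos_def)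
  have "inj_on ?f (pverts ?H)"
  proof (rule inj_onI)
    fix x y assume xy: "x \<in> pverts ?H" "y \<in> pverts ?H" "?f x = ?f y"
    then have "pos x = pos y"
      using near[of x y] cyc_eq_near_iff[of "pos x" "pos y" n] by auto
    then show "x = y"
      using xy(1,2) assms by (auto simp: verts pos_def)
  qed
  then show "bij_betw ?f (pverts ?H) (arc3 n p \<union> arc3 n q)"
    by (simp add: bij_betw_def verts arc3_def pos_def)
  fix x y assume xy: "x \<in> pverts ?H" "y \<in> pverts ?H"
  have "n > 0"
    using assms by linarith
  then have "(?f x, ?f y) \<in> parcs (F_graph n) \<longleftrightarrow> \<bar>pos x - pos y\<bar> = 1"
    using cyc_arc_near_iff near[OF xy] by blast
  also have "\<dots> \<longleftrightarrow> (x, y) \<in> parcs ?H"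
    using xy assms by (auto simp: verts pos_def disjoint_union_def path_graph_def image_iff)
  finally show "(?f x, ?f y) \<in> parcs (F_graph n) \<longleftrightarrow> (x, y) \<in> parcs ?H" .
qed (auto simp: disjoint_union_def path_graph_def)

lemma arc3_cong:
  assumes "[p = q] (mod 2 * int n)"
  shows "arc3 n p = arc3 n q"
proof -
  have "cyc n (p + i) = cyc n (q + i)" for i
    using assms by (simp add: cyc_eq_iff cong_add_rcancel)
  from this[of 0] this[of 1] this[of 2] show ?thesis
    by (simp add: arc3_def)
qed

text \<open>
  Fix the first arc at position \<open>p\<close> and move the start of the second one to a position \<open>q\<close> in the window
  \<open>[p, p + 2n)\<close>. Disjointness leaves \<open>p + 3 \<le> q \<le> p + 2n - 3\<close>. At the left end the second arc
  continues the first one and at the right end it precedes it, a path on six vertices in both cases.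
  Strictly in between at least one vertex separates the arcs on either side.
\<close>

lemma two_disjoint_arcs:
  assumes "n \<ge> 4" "arc3 n p \<inter> arc3 n r = {}"
  shows "digraph_iso (with_proj (F_graph n) \<restriction> (arc3 n p \<union> arc3 n r)) (with_proj (path_graph 6)) \<or>
    digraph_iso (with_proj (F_graph n) \<restriction> (arc3 n p \<union> arc3 n r))
      (with_proj (disjoint_union (path_graph 3) (path_graph 3)))"
proof -
  let ?N = "2 * int n"
  define q where "q = p + (r - p) mod ?N"
  have "[q = r] (mod ?N)"
    by (simp add: q_def cong_def mod_add_right_eq)
  then have rq: "arc3 n r = arc3 n q"
    using arc3_cong by (metis cong_sym)
  have range: "p \<le> q" "q < p + ?N"
    using assms(1) by (auto simp: q_def)
  \<comment> \<open>The copy of the second arc one turn earlier measures its distance to \<open>p\<close> from the other side.\<close>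
  have shift: "arc3 n (q - ?N) = arc3 n q"
    by (rule arc3_cong) (simp add: cong_iff_dvd_diff)
  have "q \<notin> {p, p + 1, p + 2}"
    using assms(2) unfolding rq by (auto simp: arc3_def)
  moreover have "p \<notin> {q - ?N, q - ?N + 1, q - ?N + 2}"
    using assms(2) unfolding rq shift[symmetric] by (auto simp: arc3_def)
  ultimately consider "q = p + 3" | "p = q - ?N + 3" | "p + 4 \<le> q" "q + 4 \<le> p + ?N"
    using range by fastforce
  then show ?thesis
  proof cases
    case 1
    then show ?thesis
      using digraph_iso_path6[OF assms(1), of p] rq by simp
  next
    case 2
    then show ?thesis
      using digraph_iso_path6[OF assms(1), of "q - ?N"] rq shift by (simp add: Un_commute)
  next
    case 3
    then show ?thesis
      using digraph_iso_two_path3[of p q n] rq by simp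
  qed
qed

section \<open>Disconnected induced subgraphs\<close>

text \<open>
  The two bicliques of \<open>F\<close> are \<open>AX \<times> BY\<close> and \<open>BX \<times> AY\<close>: a cross pair between \<open>X\<close> and \<open>Y\<close> that is not an
  edge of \<open>G\<close> is an edge of \<open>F\<close>.
\<close>

lemma disconnected_induced_G:
  assumes n: "n \<ge> 4" and U: "U \<subseteq> pverts (G_graph n)"
    and X: "card (U \<inter> X_part n) \<ge> 3" and Y: "card (U \<inter> Y_part n) \<ge> 3"
    and disc: "\<not> Digraph_Component.connected (with_proj (G_graph n) \<restriction> U)"
  shows "card (U \<inter> X_part n) = 3" "card (U \<inter> Y_part n) = 3"
    "digraph_iso (with_proj (F_graph n) \<restriction> U) (with_proj (path_graph 6)) \<or>
     digraph_iso (with_proj (F_graph n) \<restriction> U)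
       (with_proj (disjoint_union (path_graph 3) (path_graph 3)))"
proof -
  have "U \<noteq> {}"
    using X by auto
  then obtain A B where AB: "A \<union> B = U" "A \<inter> B = {}" "A \<noteq> {}" "B \<noteq> {}"
    and no_arc: "\<And>a b. a \<in> A \<Longrightarrow> b \<in> B \<Longrightarrow> (a, b) \<notin> parcs (G_graph n) \<and> (b, a) \<notin> parcs (G_graph n)"
    using disconnected_split[OF sym_G _ disc] by metis
  let ?V = "X_part n \<union> Y_part n"
  have UV: "U \<subseteq> ?V" and fin: "finite (X_part n)" "finite (Y_part n)"
    using U by (auto simp: G_graph_def X_part_def Y_part_def)
  define AX AY BX BY where "AX = A \<inter> X_part n" and "AY = A \<inter> Y_part n"
    and "BX = B \<inter> X_part n" and "BY = B \<inter> Y_part n"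
  note parts = AX_def AY_def BX_def BY_def
  have sub: "AX \<subseteq> ?V" "AY \<subseteq> ?V" "BX \<subseteq> ?V" "BY \<subseteq> ?V"
    by (auto simp: parts)
  have UX: "card (U \<inter> X_part n) = card AX + card BX"
    using AB fin unfolding parts by (subst card_Un_disjoint[symmetric]) (auto intro: arg_cong[of _ _ card])
  have UY: "card (U \<inter> Y_part n) = card AY + card BY"
    using AB fin unfolding parts by (subst card_Un_disjoint[symmetric]) (auto intro: arg_cong[of _ _ card])
  have AXBY: "AX \<times> BY \<subseteq> parcs (F_graph n)" and BXAY: "BX \<times> AY \<subseteq> parcs (F_graph n)"
    using no_arc by (auto simp: parts G_graph_def)
  then have BYAX: "BY \<times> AX \<subseteq> parcs (F_graph n)" and AYBX: "AY \<times> BX \<subseteq> parcs (F_graph n)"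
    using sym_F[of n] by (auto dest: symD)
  have n3: "n \<ge> 3"
    using n by simp
  note side = biclique_side(1)[OF n3]
  have "A = AX \<union> AY" "B = BX \<union> BY"
    using AB UV by (auto simp: parts)
  \<comment> \<open>If one of the four sets were empty, its partner in \<open>X\<close> or \<open>Y\<close> would have three elements and so admit
    no vertex on the opposite side of its biclique, which empties \<open>A\<close> or \<open>B\<close>.\<close>
  then have nonempty: "AX \<noteq> {}" "AY \<noteq> {}" "BX \<noteq> {}" "BY \<noteq> {}"
    using AB(3,4) X Y UX UY side[OF AXBY] side[OF BXAY] side[OF BYAX] side[OF AYBX] sub
    by fastforce+
  note P = biclique_F[OF n3 AXBY nonempty(1,4)] and Q = biclique_F[OF n3 BXAY nonempty(3,2)]
  have "card AX + card BY \<le> 3" "card BX + card AY \<le> 3"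
    using P(1) Q(1) sub by auto
  \<comment> \<open>The four cardinalities sum to at least six over \<open>X\<close> and \<open>Y\<close>, but to at most six over the bicliques.\<close>
  then have eq3: "card AX + card BY = 3" "card BX + card AY = 3"
    and cards: "card (U \<inter> X_part n) = 3" "card (U \<inter> Y_part n) = 3"
    using X Y UX UY by linarith+
  show "card (U \<inter> X_part n) = 3" "card (U \<inter> Y_part n) = 3"
    by (fact cards)+
  obtain p r where p: "AX \<union> BY = arc3 n p" and r: "BX \<union> AY = arc3 n r"
    using P(2)[OF _ eq3(1)] Q(2)[OF _ eq3(2)] sub by (metis Un_least)
  have "X_part n \<inter> Y_part n = {}"
    by (auto simp: X_part_def Y_part_def u_vert_def v_vert_def)
  then have "arc3 n p \<inter> arc3 n r = {}"
    using AB(2) unfolding p[symmetric] r[symmetric] parts by auto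
  moreover have "U = arc3 n p \<union> arc3 n r"
    using AB(1) \<open>A = AX \<union> AY\<close> \<open>B = BX \<union> BY\<close> p r by auto
  ultimately show "digraph_iso (with_proj (F_graph n) \<restriction> U) (with_proj (path_graph 6)) \<or>
     digraph_iso (with_proj (F_graph n) \<restriction> U)
       (with_proj (disjoint_union (path_graph 3) (path_graph 3)))"
    using two_disjoint_arcs[OF n] by metis
qed

theorem lemma3p2:
  fixes n :: nat and U :: "(int + int) set"
  assumes "n \<ge> 5"
    and "U \<subset> pverts (G_graph n)"
    and "card (U \<inter> X_part n) \<ge> 3"
    and "card (U \<inter> Y_part n) \<ge> 3"
  shows "(\<not> Digraph_Component.connected (with_proj (G_graph n) \<restriction> U) \<longrightarrow>
      card (U \<inter> X_part n) = 3 \<and> card (U \<inter> Y_part n) = 3 \<and>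
      (digraph_iso (with_proj (F_graph n) \<restriction> U) (with_proj (path_graph 6)) \<or>
       digraph_iso (with_proj (F_graph n) \<restriction> U)
         (with_proj (disjoint_union (path_graph 3) (path_graph 3))))) \<and>
    (card U \<ge> 7 \<longrightarrow> Digraph_Component.connected (with_proj (G_graph n) \<restriction> U))"
proof -
  have U: "U \<subseteq> pverts (G_graph n)" and n: "n \<ge> 4"
    using assms(1,2) by auto
  note disc = disconnected_induced_G[OF n U assms(3,4)]
  have "finite (X_part n)" "finite (Y_part n)" "X_part n \<inter> Y_part n = {}"
    by (auto simp: X_part_def Y_part_def u_vert_def v_vert_def)
  moreover have "U = (U \<inter> X_part n) \<union> (U \<inter> Y_part n)"
    using U by (auto simp: G_graph_def)
  ultimately have "card U = card (U \<inter> X_part n) + card (U \<inter> Y_part n)"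
    by (metis (no_types, lifting) card_Un_disjoint disjoint_iff finite_Int IntD2)
  then show ?thesis
    using disc by fastforce
qed

end
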